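(* The centralizer of a finite subset of a biautomatic group is biautomatic.
   Context: Let $A$ be a finite alphabet and $\pi:A^*\to G$ a surjective (monoid) homomorphism onto a group $G$. For $u,v\in A^*$, $u\diamond v$ is the unique word over $(A\times A)\cup(A\times\{\$\})\cup(\{\$\}\times A)$ (where $\$\notin A$) whose projection to the first (resp. second) component lies in $u\$^*$ (resp. $v\$^*$). A biautomatic structure for $\pi$ is a rational (regular) language $L\subseteq A^*$ with $L\pi=G$ such that for every $x\in A\cup\{1\}$ the languages $\{u\diamond v\mid u,v\in L,\ v\pi=(ux)\pi\}$ and $\{u\diamond v\mid u,v\in L,\ v\pi=(xu)\pi\}$ are recognized by finite state automata. A group is biautomatic if it has a biautomatic structure for some $A$ and $\pi$. *)

theory Defs
  imports "HOL-Algebra.Group"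
begin

subsection \<open>Regular languages\<close>

record ('s, 'a) automaton =
  states :: "'s set"
  start :: 's
  final :: "'s set"
  trans_fun :: "'s \<Rightarrow> 'a \<Rightarrow> 's"

definition finite_state_automaton :: "'a set \<Rightarrow> ('s, 'a) automaton \<Rightarrow> bool" where
  "finite_state_automaton \<Sigma> M \<longleftrightarrow>
     finite \<Sigma> \<and> finite (states M) \<and> start M \<in> states M \<and> final M \<subseteq> states M \<and>
     (\<forall>q\<in>states M. \<forall>a\<in>\<Sigma>. trans_fun M q a \<in> states M)"

definition language :: "'a set \<Rightarrow> ('s, 'a) automaton \<Rightarrow> 'a list set" where
  "language \<Sigma> M = {w \<in> lists \<Sigma>. foldl (trans_fun M) (start M) w \<in> final M}"

text \<open>Naming the states by natural numbers is no restriction, because the state set is finite.\<close>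

definition regular :: "'a set \<Rightarrow> 'a list set \<Rightarrow> bool" where
  "regular \<Sigma> L \<longleftrightarrow> (\<exists>M :: (nat, 'a) automaton. finite_state_automaton \<Sigma> M \<and> L = language \<Sigma> M)"


subsection \<open>Padded pairs of words\<close>

text \<open>A letter \<open>a\<close> is encoded as \<open>Some a\<close> and the padding symbol \<open>$\<close> as \<open>None\<close>;
  the letter \<open>($, $)\<close> is excluded.\<close>

definition pair_alphabet :: "'a set \<Rightarrow> ('a option \<times> 'a option) set" where
  "pair_alphabet A =
     (Some ` A \<times> Some ` A) \<union> (Some ` A \<times> {None}) \<union> ({None} \<times> Some ` A)"

definition padded_by :: "'a list \<Rightarrow> 'a option list \<Rightarrow> bool" where
  "padded_by u w \<longleftrightarrow> (\<exists>n. w = map Some u @ replicate n None)"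

definition diamond :: "'a list \<Rightarrow> 'a list \<Rightarrow> ('a option \<times> 'a option) list"
    (infix "\<diamond>" 60) where
  "u \<diamond> v = (THE w. w \<in> lists (pair_alphabet UNIV) \<and>
                   padded_by u (map fst w) \<and> padded_by v (map snd w))"

lemma padded_by_simps [simp]:
  "padded_by [] []"
  "padded_by (a # u) [] \<longleftrightarrow> False"
  "padded_by [] (x # w) \<longleftrightarrow> x = None \<and> padded_by [] w"
  "padded_by (a # u) (x # w) \<longleftrightarrow> x = Some a \<and> padded_by u w"
  by (auto simp: padded_by_def Cons_replicate_eq)

text \<open>Existence and uniqueness of \<open>u \<diamond> v\<close>, and the fact that it only uses the letters
  of any alphabet over which \<open>u\<close> and \<open>v\<close> are words.\<close>

fun pad_pair :: "'a list \<Rightarrow> 'a list \<Rightarrow> ('a option \<times> 'a option) list" where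
  "pad_pair [] [] = []"
| "pad_pair (a # u) [] = (Some a, None) # pad_pair u []"
| "pad_pair [] (b # v) = (None, Some b) # pad_pair [] v"
| "pad_pair (a # u) (b # v) = (Some a, Some b) # pad_pair u v"

lemma pad_pair_unique:
  assumes "u \<in> lists A" "v \<in> lists A"
  shows "w \<in> lists (pair_alphabet A) \<and> padded_by u (map fst w) \<and> padded_by v (map snd w)
           \<longleftrightarrow> w = pad_pair u v"
  using assms
proof (induction u v arbitrary: w rule: pad_pair.induct)
  case 1
  then show ?case by (cases w) (auto simp: pair_alphabet_def)
next
  case (2 a u)
  then show ?case by (cases w) (auto simp: pair_alphabet_def)
next
  case (3 b v)
  then show ?case by (cases w) (auto simp: pair_alphabet_def)
next
  case (4 a u b v)
  then show ?case by (cases w) (auto simp: pair_alphabet_def)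
qed

lemma diamond_eq_pad_pair: "u \<diamond> v = pad_pair u v"
  using pad_pair_unique[of u UNIV v] by (simp add: diamond_def)

lemma diamond_unique:
  assumes "u \<in> lists A" "v \<in> lists A"
  shows "w \<in> lists (pair_alphabet A) \<and> padded_by u (map fst w) \<and> padded_by v (map snd w)
           \<longleftrightarrow> w = u \<diamond> v"
  using pad_pair_unique[OF assms] by (simp add: diamond_eq_pad_pair)


subsection \<open>Biautomatic groups\<close>

definition free_monoid :: "'a set \<Rightarrow> 'a list monoid" where
  "free_monoid A = \<lparr>carrier = lists A, mult = (@), one = []\<rparr>"

text \<open>In \<open>biautomatic_structure\<close>, the parameter \<open>x \<in> A \<union> {1}\<close> ranges over the words of length
  at most one over \<open>A\<close>, the empty word being the identity of the free monoid.\<close>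

definition biautomatic_structure ::
    "('g, 'b) monoid_scheme \<Rightarrow> 'a set \<Rightarrow> ('a list \<Rightarrow> 'g) \<Rightarrow> 'a list set \<Rightarrow> bool" where
  "biautomatic_structure G A \<pi> L \<longleftrightarrow>
     finite A \<and>
     \<pi> \<in> hom (free_monoid A) G \<and> \<pi> [] = \<one>\<^bsub>G\<^esub> \<and> \<pi> ` lists A = carrier G \<and>
     regular A L \<and> \<pi> ` L = carrier G \<and>
     (\<forall>x \<in> {[]} \<union> {[a] | a. a \<in> A}.
        regular (pair_alphabet A) {u \<diamond> v | u v. u \<in> L \<and> v \<in> L \<and> \<pi> v = \<pi> (u @ x)} \<and>
        regular (pair_alphabet A) {u \<diamond> v | u v. u \<in> L \<and> v \<in> L \<and> \<pi> v = \<pi> (x @ u)})"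

text \<open>Every finite alphabet is in bijection with a finite set of natural numbers, so it
  suffices to consider alphabets of the latter kind.\<close>

definition biautomatic :: "('g, 'b) monoid_scheme \<Rightarrow> bool" where
  "biautomatic G \<longleftrightarrow>
     group G \<and> (\<exists>(A :: nat set) \<pi> L. biautomatic_structure G A \<pi> L)"

definition centralizer :: "('g, 'b) monoid_scheme \<Rightarrow> 'g set \<Rightarrow> 'g set" where
  "centralizer G S = {g \<in> carrier G. \<forall>s\<in>S. g \<otimes>\<^bsub>G\<^esub> s = s \<otimes>\<^bsub>G\<^esub> g}"

end

theory Submission
  imports Defs "HOL-Library.Nat_Bijection"
begin

text \<open>
  Let \<open>L\<close> be the language of a biautomatic structure for \<open>G\<close> and \<open>C\<close> the centralizer of \<open>S\<close>.
  The proof, going back to Gersten and Short, has two halves.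

  \<^emph>\<open>The words of \<open>L\<close> that represent elements of \<open>C\<close> form a regular language.\<close>
  For \<open>g, h \<in> G\<close> consider the relation on \<open>L\<close> that relates \<open>u\<close> to \<open>v\<close> if \<open>v\<close> represents
  \<open>g u h\<close>. A biautomatic structure makes it regular, in the sense of padded pairs, when one of
  \<open>g\<close>, \<open>h\<close> is a generator and the other one is trivial. Since every element of \<open>G\<close> has a
  representative in \<open>L\<close>, these relations compose like the pairs \<open>(g, h)\<close>, and compositions of
  regular relations are regular; so all of them are regular (\<open>regular_multiplier\<close>). Now a word
  commutes with \<open>s\<close> iff it is related to itself for \<open>g = s\<^sup>-\<^sup>1\<close> and \<open>h = s\<close>. The diagonal of a
  regular relation is a regular language, and \<open>S\<close> is finite (\<open>regular_centralizer\<close>).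

  \<^emph>\<open>A subgroup \<open>H\<close> with a regular language of representatives in \<open>L\<close> is biautomatic\<close>
  (\<open>rational_subgroup_biautomatic\<close>). An automaton for this language shows that \<open>H\<close> is
  quasiconvex: if a word \<open>u\<close> leads to a state \<open>q\<close> from which a final state can be reached along a
  word \<open>z\<close>, then \<open>u z\<close> represents an element of \<open>H\<close>. Let \<open>h q\<close> be the value of one such \<open>z\<close>,
  or the identity if \<open>q\<close> is initial or final, where it serves the same purpose. One replaces every
  letter \<open>a\<close> read in state \<open>q\<close> by the element
  \<open>(h q)\<^sup>-\<^sup>1 a (h q')\<close> of \<open>H\<close>, where \<open>q'\<close> is the next state. Along an accepting run these elements
  multiply to the element that the original word represents. So the accepting runs, read as
  words over the finite set of transitions, represent exactly the elements of \<open>H\<close>. Forgetting the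
  states is a letter-to-letter map, hence the relations needed for \<open>H\<close> are inverse images of the
  relations for \<open>G\<close>.
\<close>

section \<open>Regular languages and their residuals\<close>

text \<open>Regularity is handled through the Myhill--Nerode criterion: a closure property then only
  requires expressing the residuals of the new language by residuals of the given ones, and no
  automaton has to be constructed.\<close>

definition residual :: "'a list \<Rightarrow> 'a list set \<Rightarrow> 'a list set" where
  "residual u L = {v. u @ v \<in> L}"

lemma residual_Nil [simp]: "residual [] L = L"
  by (simp add: residual_def)

lemma residual_append: "residual (u @ v) L = residual v (residual u L)"
  by (simp add: residual_def)

lemma finite_state_automaton_run:
  assumes "finite_state_automaton \<Sigma> M" "q \<in> states M" "w \<in> lists \<Sigma>"
  shows "foldl (trans_fun M) q w \<in> states M"
  using assms(3,2) assms(1) by (induction w arbitrary: q) (auto simp: finite_state_automaton_def)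

lemma regular_iff_finite_residuals:
  "regular \<Sigma> L \<longleftrightarrow> finite \<Sigma> \<and> L \<subseteq> lists \<Sigma> \<and> finite ((\<lambda>w. residual w L) ` lists \<Sigma>)"
proof
  assume "regular \<Sigma> L"
  then obtain M :: "(nat, 'a) automaton"
    where M: "finite_state_automaton \<Sigma> M" and L: "L = language \<Sigma> M"
    by (auto simp: regular_def)
  define F where "F q = {v \<in> lists \<Sigma>. foldl (trans_fun M) q v \<in> final M}" for q
  have "residual w L = F (foldl (trans_fun M) (start M) w)" if "w \<in> lists \<Sigma>" for w
    using that by (auto simp: residual_def L language_def F_def)
  moreover have "foldl (trans_fun M) (start M) w \<in> states M" if "w \<in> lists \<Sigma>" for w
    using finite_state_automaton_run[OF M _ that] M by (simp add: finite_state_automaton_def)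
  ultimately have "(\<lambda>w. residual w L) ` lists \<Sigma> \<subseteq> F ` states M"
    by auto
  then show "finite \<Sigma> \<and> L \<subseteq> lists \<Sigma> \<and> finite ((\<lambda>w. residual w L) ` lists \<Sigma>)"
    using M finite_subset[of _ "F ` states M"]
    by (auto simp: finite_state_automaton_def L language_def)
next
  assume *: "finite \<Sigma> \<and> L \<subseteq> lists \<Sigma> \<and> finite ((\<lambda>w. residual w L) ` lists \<Sigma>)"
  define Q where "Q = (\<lambda>w. residual w L) ` lists \<Sigma>"
  have "finite Q"
    using * by (simp add: Q_def)
  \<comment> \<open>The residuals, numbered by \<open>f\<close>, are the states of the minimal automaton.\<close>
  then obtain f :: "'a list set \<Rightarrow> nat" where f: "inj_on f Q"
    using finite_imp_inj_to_nat_seg by blast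
  define M where "M = \<lparr>states = f ` Q, start = f L, final = f ` {X \<in> Q. [] \<in> X},
    trans_fun = (\<lambda>n a. f (residual [a] (inv_into Q f n)))\<rparr>"
  have Q_res: "residual w L \<in> Q" if "w \<in> lists \<Sigma>" for w
    using that by (simp add: Q_def)
  have L_Q: "L \<in> Q"
    using Q_res[of "[]"] by simp
  have step: "residual [a] X \<in> Q" if "X \<in> Q" "a \<in> \<Sigma>" for X a
    using that Q_res by (fastforce simp: Q_def simp flip: residual_append)
  have run: "foldl (trans_fun M) (f X) w = f (residual w X)" if "X \<in> Q" "w \<in> lists \<Sigma>" for X w
    using that(2,1)
  proof (induction w arbitrary: X)
    case (Cons a w)
    then show ?case
      using step[of X a] residual_append[of "[a]" w X] f by (simp add: M_def)
  qed simp
  have "finite_state_automaton \<Sigma> M"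
    using * \<open>finite Q\<close> L_Q step f by (auto simp: finite_state_automaton_def M_def)
  moreover have "foldl (trans_fun M) (start M) w \<in> final M \<longleftrightarrow> w \<in> L" if "w \<in> lists \<Sigma>" for w
  proof -
    have "foldl (trans_fun M) (start M) w = f (residual w L)"
      using run[OF L_Q that] by (simp add: M_def)
    moreover have "f (residual w L) \<in> final M \<longleftrightarrow> [] \<in> residual w L"
      using f Q_res[OF that] by (auto simp: M_def dest: inj_onD)
    ultimately show ?thesis
      by (simp add: residual_def)
  qed
  then have "L = language \<Sigma> M"
    using * by (auto simp: language_def)
  ultimately show "regular \<Sigma> L"
    by (auto simp: regular_def)
qed

lemma regularI:
  assumes "finite \<Sigma>" "L \<subseteq> lists \<Sigma>" "finite \<Q>" "\<And>w. w \<in> lists \<Sigma> \<Longrightarrow> residual w L \<in> \<Q>"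
  shows "regular \<Sigma> L"
proof -
  have "(\<lambda>w. residual w L) ` lists \<Sigma> \<subseteq> \<Q>"
    using assms(4) by auto
  then show ?thesis
    using assms(1-3) by (auto simp: regular_iff_finite_residuals intro: finite_subset)
qed

lemma regular_finite_alphabet: "regular \<Sigma> L \<Longrightarrow> finite \<Sigma>"
  and regular_subset_lists: "regular \<Sigma> L \<Longrightarrow> L \<subseteq> lists \<Sigma>"
  and regular_finite_residuals: "regular \<Sigma> L \<Longrightarrow> finite ((\<lambda>w. residual w L) ` lists \<Sigma>)"
  by (simp_all add: regular_iff_finite_residuals)


subsection \<open>Closure properties\<close>

lemma regular_Int:
  assumes "regular \<Sigma> K" "regular \<Sigma> L"
  shows "regular \<Sigma> (K \<inter> L)"
proof (rule regularI)
  let ?R = "\<lambda>L. (\<lambda>w. residual w L) ` lists \<Sigma>"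
  show "finite ((\<lambda>(X, Y). X \<inter> Y) ` (?R K \<times> ?R L))"
    using assms by (simp add: regular_iff_finite_residuals)
  show "residual w (K \<inter> L) \<in> (\<lambda>(X, Y). X \<inter> Y) ` (?R K \<times> ?R L)" if "w \<in> lists \<Sigma>" for w
  proof -
    have "residual w (K \<inter> L) = residual w K \<inter> residual w L"
      by (auto simp: residual_def)
    with that show ?thesis by force
  qed
qed (use assms in \<open>auto simp: regular_iff_finite_residuals\<close>)

lemma regular_vimage_map:
  assumes "regular \<Sigma> L" "finite \<Gamma>" "f ` \<Gamma> \<subseteq> \<Sigma>"
  shows "regular \<Gamma> {w \<in> lists \<Gamma>. map f w \<in> L}"
proof (rule regularI)
  let ?V = "\<lambda>X. {w \<in> lists \<Gamma>. map f w \<in> X}"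
  show "finite (?V ` (\<lambda>w. residual w L) ` lists \<Sigma>)"
    using regular_finite_residuals[OF assms(1)] by (rule finite_imageI)
  show "residual w (?V L) \<in> ?V ` (\<lambda>w. residual w L) ` lists \<Sigma>" if "w \<in> lists \<Gamma>" for w
  proof -
    have "residual w (?V L) = ?V (residual (map f w) L)"
      using that by (auto simp: residual_def)
    moreover have "map f w \<in> lists \<Sigma>"
      using that assms(3) by (auto simp: image_subset_iff)
    ultimately show ?thesis by blast
  qed
qed (use assms(2) in auto)

text \<open>This is the subset construction: a residual of the image is a union of images of residuals,
  and a finite family has finitely many subfamilies.\<close>

lemma regular_image_map:
  assumes "regular \<Sigma> L"
  shows "regular (f ` \<Sigma>) (map f ` L)"
proof (rule regularI)
  let ?R = "(\<lambda>w. residual w L) ` lists \<Sigma>"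
  show "finite ((\<lambda>\<X>. \<Union>X\<in>\<X>. map f ` X) ` Pow ?R)"
    using regular_finite_residuals[OF assms] by simp
  show "residual w (map f ` L) \<in> (\<lambda>\<X>. \<Union>X\<in>\<X>. map f ` X) ` Pow ?R" for w
  proof
    let ?\<X> = "(\<lambda>w. residual w L) ` {u \<in> lists \<Sigma>. map f u = w}"
    show "?\<X> \<in> Pow ?R" by auto
    show "residual w (map f ` L) = (\<Union>X\<in>?\<X>. map f ` X)"
    proof (intro equalityI subsetI)
      fix v assume "v \<in> residual w (map f ` L)"
      then obtain u where u: "u \<in> L" "map f u = w @ v"
        by (auto simp: residual_def)
      then obtain u1 u2 where "u = u1 @ u2" "map f u1 = w" "map f u2 = v"
        by (auto simp: map_eq_append_conv)
      with u regular_subset_lists[OF assms] show "v \<in> (\<Union>X\<in>?\<X>. map f ` X)"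
        by (fastforce simp: residual_def)
    next
      fix v assume "v \<in> (\<Union>X\<in>?\<X>. map f ` X)"
      then obtain u1 u2 where "u1 @ u2 \<in> L" "w = map f u1" "v = map f u2"
        by (auto simp: residual_def)
      then show "v \<in> residual w (map f ` L)"
        by (auto simp: residual_def simp flip: map_append)
    qed
  qed
  show "map f ` L \<subseteq> lists (f ` \<Sigma>)"
    using regular_subset_lists[OF assms] by fastforce
qed (use regular_finite_alphabet[OF assms] in simp)

lemma regular_alphabet_mono:
  assumes "regular \<Sigma> L" "\<Sigma> \<subseteq> \<Gamma>" "finite \<Gamma>"
  shows "regular \<Gamma> L"
proof (rule regularI)
  let ?R = "(\<lambda>w. residual w L) ` lists \<Sigma>"
  show "finite (insert {} ?R)"
    using regular_finite_residuals[OF assms(1)] by simp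
  show "residual w L \<in> insert {} ?R" for w
    using regular_subset_lists[OF assms(1)] by (cases "w \<in> lists \<Sigma>") (auto simp: residual_def)
qed (use assms(2,3) regular_subset_lists[OF assms(1)] lists_mono[of \<Sigma> \<Gamma>] in auto)

text \<open>Once the word read so far lies in \<open>Lc\<^sup>*\<close>, any further power of \<open>c\<close> may follow; the other
  continuations first complete a word of \<open>L\<close>. So a residual is determined by a residual of \<open>L\<close>
  and by one bit, the set \<open>Y\<close> below being \<open>{[]}\<close> or empty.\<close>

lemma regular_append_star:
  assumes "regular \<Sigma> L"
  shows "regular (insert c \<Sigma>) {u @ replicate n c | u n. u \<in> L}"
proof (rule regularI)
  let ?\<Gamma> = "insert c \<Sigma>"
  have L: "regular ?\<Gamma> L"
    using assms regular_finite_alphabet by (blast intro: regular_alphabet_mono)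
  let ?R = "(\<lambda>w. residual w L) ` lists ?\<Gamma>" and ?S = "\<lambda>X. {u @ replicate n c | u n. u \<in> X}"
  let ?\<Q> = "(\<lambda>(X, Y). ?S X \<union> ?S Y) ` (?R \<times> {{}, {[]}})"
  show "finite ?\<Q>"
    using regular_finite_residuals[OF L] by simp
  show "residual w (?S L) \<in> ?\<Q>" if w: "w \<in> lists ?\<Gamma>" for w
  proof
    let ?Y = "if w \<in> ?S L then {[]} else {}"
    show "(residual w L, ?Y) \<in> ?R \<times> {{}, {[]}}"
      using w by auto
    have "residual w (?S L) = ?S (residual w L) \<union> ?S ?Y"
    proof (intro equalityI subsetI)
      fix v assume "v \<in> residual w (?S L)"
      then obtain u n where un: "u \<in> L" "w @ v = u @ replicate n c"
        by (auto simp: residual_def)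
      then consider x where "u = w @ x" "v = x @ replicate n c"
        | x where "w = u @ x" "x @ v = replicate n c"
        by (auto simp: append_eq_append_conv2)
      then show "v \<in> ?S (residual w L) \<union> ?S ?Y"
      proof cases
        case 1
        with un show ?thesis by (auto simp: residual_def)
      next
        case 2
        then have "x = replicate (length x) c" "v = replicate (length v) c"
          using replicate_eqI[of x _ c] replicate_eqI[of v _ c] in_set_replicate[of _ n c]
          by (metis Un_iff set_append)+
        with 2(1) un(1) have "w \<in> ?S L" "v \<in> ?S {[]}"
          by (simp, metis, simp, metis)
        then show ?thesis by simp
      qed
    next
      fix v assume "v \<in> ?S (residual w L) \<union> ?S ?Y"
      then consider x n where "w @ x \<in> L" "v = x @ replicate n c"
        | x m n where "x \<in> L" "w = x @ replicate m c" "v = replicate n c"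
        by (auto simp: residual_def split: if_splits)
      then show "v \<in> residual w (?S L)"
      proof cases
        case 1
        then have "w @ v = (w @ x) @ replicate n c" by simp
        with 1(1) show ?thesis unfolding residual_def by blast
      next
        case 2
        then have "w @ v = x @ replicate (m + n) c" by (simp add: replicate_add)
        with 2 show ?thesis unfolding residual_def by blast
      qed
    qed
    then show "residual w (?S L) = (case (residual w L, ?Y) of (X, Y) \<Rightarrow> ?S X \<union> ?S Y)"
      by simp
  qed
  show "?S L \<subseteq> lists ?\<Gamma>"
    using regular_subset_lists[OF assms] by fastforce
qed (use regular_finite_alphabet[OF assms] in simp)

lemma regular_strip_star:
  assumes "regular \<Sigma> L"
  shows "regular \<Sigma> {w. \<exists>n. w @ replicate n c \<in> L}"
proof (rule regularI)
  let ?S = "\<lambda>X. {w. \<exists>n. w @ replicate n c \<in> X}"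
  show "finite (?S ` (\<lambda>w. residual w L) ` lists \<Sigma>)"
    using regular_finite_residuals[OF assms] by (rule finite_imageI)
  show "residual w (?S L) \<in> ?S ` (\<lambda>w. residual w L) ` lists \<Sigma>" if "w \<in> lists \<Sigma>" for w
  proof -
    have "residual w (?S L) = ?S (residual w L)"
      by (simp add: residual_def)
    with that show ?thesis by blast
  qed
  show "?S L \<subseteq> lists \<Sigma>"
    using regular_subset_lists[OF assms] by auto
qed (use regular_finite_alphabet[OF assms] in simp)


section \<open>Synchronously regular relations\<close>

text \<open>The word \<open>u \<diamond> v\<close> has no superfluous padding. For compositions this is inconvenient,
  because the intermediate word can be longer than the two outer ones. Therefore relations are
  mostly studied through \<open>padded_language\<close>, where any amount of common padding is allowed.\<close>

abbreviation padded_alphabet :: "'a set \<Rightarrow> 'a option set" where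
  "padded_alphabet A \<equiv> insert None (Some ` A)"

abbreviation regular_relation :: "'a set \<Rightarrow> ('a list \<times> 'a list) set \<Rightarrow> bool" where
  "regular_relation A R \<equiv> regular (pair_alphabet A) ((\<lambda>(u, v). u \<diamond> v) ` R)"

definition padded_language :: "('a list \<times> 'a list) set \<Rightarrow> ('a option \<times> 'a option) list set" where
  "padded_language R = {w. \<exists>(u, v) \<in> R. padded_by u (map fst w) \<and> padded_by v (map snd w)}"

lemma padded_by_unique: "padded_by u w \<Longrightarrow> padded_by v w \<Longrightarrow> u = v"
proof (induction w arbitrary: u v)
  case (Cons x w)
  then show ?case by (cases u; cases v) auto
qed (auto simp: padded_by_def)

lemma padded_by_append_None [simp]: "padded_by u (w @ replicate n None) \<longleftrightarrow> padded_by u w"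
proof (induction w arbitrary: u)
  case Nil
  show ?case
    by (cases u; cases n) (auto simp: padded_by_def Cons_replicate_eq)
next
  case (Cons x w)
  then show ?case by (cases u) auto
qed

lemma padded_by_lists: "padded_by u w \<Longrightarrow> w \<in> lists (padded_alphabet A) \<longleftrightarrow> u \<in> lists A"
  by (auto simp: padded_by_def)

lemma pair_alphabet_eq: "pair_alphabet A = padded_alphabet A \<times> padded_alphabet A - {(None, None)}"
  by (auto simp: pair_alphabet_def)

lemma finite_pair_alphabet: "finite A \<Longrightarrow> finite (pair_alphabet A)"
  by (simp add: pair_alphabet_eq)

lemma finite_pair_alphabetD: "finite (pair_alphabet A) \<Longrightarrow> finite A"
proof -
  assume fin: "finite (pair_alphabet A)"
  have "(\<lambda>a. (Some a, None)) ` A \<subseteq> pair_alphabet A"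
    by (auto simp: pair_alphabet_def)
  then have "finite ((\<lambda>a. (Some a, None :: 'a option)) ` A)"
    using fin by (rule finite_subset)
  then show "finite A"
    by (rule finite_imageD) (auto simp: inj_on_def)
qed

lemma diamond_in_lists: "u \<in> lists A \<Longrightarrow> v \<in> lists A \<Longrightarrow> u \<diamond> v \<in> lists (pair_alphabet A)"
  using diamond_unique[of u A v "u \<diamond> v"] by simp

lemma padded_by_diamond [simp]:
  "padded_by u (map fst (u \<diamond> v))" "padded_by v (map snd (u \<diamond> v))"
  using diamond_unique[of u UNIV v "u \<diamond> v"] by simp_all

lemma diamond_eqI:
  assumes "padded_by u (map fst w)" "padded_by v (map snd w)" "(None, None) \<notin> set w"
  shows "w = u \<diamond> v"
proof -
  have "w \<in> lists (pair_alphabet UNIV)"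
    using assms(3) by (auto simp: pair_alphabet_eq) (metis not_None_eq rangeI)+
  with assms(1,2) show ?thesis
    using diamond_unique[of u UNIV v w] by simp
qed

lemma diamond_inject: "u \<diamond> v = u' \<diamond> v' \<longleftrightarrow> u = u' \<and> v = v'"
  using padded_by_diamond padded_by_unique by metis

lemma map_diamond:
  "map (map_prod (map_option f) (map_option f)) (u \<diamond> v) = map f u \<diamond> map f v"
  unfolding diamond_eq_pad_pair by (induction u v rule: pad_pair.induct) auto

lemma diamond_image: "(\<lambda>(u, v). u \<diamond> v) ` R = {u \<diamond> v | u v. (u, v) \<in> R}"
  by auto

lemma diamond_same: "u \<diamond> u = map (\<lambda>a. (Some a, Some a)) u"
  unfolding diamond_eq_pad_pair by (induction u) auto

lemma padded_language_eq:
  "padded_language R = {w @ replicate n (None, None) | w n. w \<in> (\<lambda>(u, v). u \<diamond> v) ` R}"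
proof (intro equalityI subsetI)
  fix w :: "('a option \<times> 'a option) list" assume "w \<in> padded_language R"
  then obtain u v where uv: "(u, v) \<in> R" "padded_by u (map fst w)" "padded_by v (map snd w)"
    by (auto simp: padded_language_def)
  have "\<exists>n. w = (u \<diamond> v) @ replicate n (None, None)"
    using uv(2,3)
  proof (induction u v arbitrary: w rule: pad_pair.induct)
    case 1
    then have "w = replicate (length w) (None, None)"
      by (induction w) auto
    then show ?case by (auto simp: diamond_eq_pad_pair)
  next
    case (2 a u)
    then show ?case by (cases w) (fastforce simp: diamond_eq_pad_pair)+
  next
    case (3 b v)
    then show ?case by (cases w) (fastforce simp: diamond_eq_pad_pair)+
  next
    case (4 a u b v)
    then show ?case by (cases w) (fastforce simp: diamond_eq_pad_pair)+
  qed
  with uv(1) show "w \<in> {w @ replicate n (None, None) | w n. w \<in> (\<lambda>(u, v). u \<diamond> v) ` R}"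
    by auto
next
  fix w :: "('a option \<times> 'a option) list"
  assume "w \<in> {w @ replicate n (None, None) | w n. w \<in> (\<lambda>(u, v). u \<diamond> v) ` R}"
  then obtain u v n where "(u, v) \<in> R" "w = (u \<diamond> v) @ replicate n (None, None)"
    by auto
  then show "w \<in> padded_language R"
    by (auto simp: padded_language_def map_replicate_const intro!: bexI[of _ "(u, v)"])
qed

lemma regular_padded_language:
  assumes "regular_relation A R"
  shows "regular (padded_alphabet A \<times> padded_alphabet A) (padded_language R)"
proof -
  have "insert (None, None) (pair_alphabet A) = padded_alphabet A \<times> padded_alphabet A"
    by (auto simp: pair_alphabet_eq)
  then show ?thesis
    using regular_append_star[OF assms, of "(None, None)"] by (simp add: padded_language_eq)
qed

lemma diamond_image_eq:
  assumes "R \<subseteq> lists A \<times> lists A"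
  shows "(\<lambda>(u, v). u \<diamond> v) ` R = {w \<in> lists (pair_alphabet A). w \<in> padded_language R}"
proof (intro equalityI subsetI)
  fix w assume "w \<in> (\<lambda>(u, v). u \<diamond> v) ` R"
  then obtain u v where uv: "(u, v) \<in> R" and w: "w = u \<diamond> v"
    by auto
  then have "u \<in> lists A" "v \<in> lists A"
    using assms by auto
  then have "w \<in> lists (pair_alphabet A)"
    unfolding w by (rule diamond_in_lists)
  moreover have "w \<in> padded_language R"
    using uv by (auto simp: w padded_language_def intro!: bexI[of _ "(u, v)"])
  ultimately show "w \<in> {w \<in> lists (pair_alphabet A). w \<in> padded_language R}"
    by simp
next
  fix w assume "w \<in> {w \<in> lists (pair_alphabet A). w \<in> padded_language R}"
  then show "w \<in> (\<lambda>(u, v). u \<diamond> v) ` R"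
    by (force simp: padded_language_def pair_alphabet_eq dest: diamond_eqI)
qed

lemma regular_relationI:
  assumes "regular (padded_alphabet A \<times> padded_alphabet A) (padded_language R)"
    and "R \<subseteq> lists A \<times> lists A"
  shows "regular_relation A R"
proof -
  have "finite (pair_alphabet A)"
    using regular_finite_alphabet[OF assms(1)] by (simp add: pair_alphabet_eq)
  then show ?thesis
    using regular_vimage_map[OF assms(1), of "pair_alphabet A" id] diamond_image_eq[OF assms(2)]
    by (auto simp: pair_alphabet_eq)
qed

text \<open>The intermediate word is guessed on a third track, and the track is erased afterwards. Since
  it may be longer than the outer words, these have to be extended by common padding, which is
  stripped after the projection.\<close>

lemma padded_language_relcomp:
  assumes "R \<subseteq> lists A \<times> lists A" "S \<subseteq> lists A \<times> lists A"
  defines "T \<equiv> padded_alphabet A \<times> padded_alphabet A \<times> padded_alphabet A"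
  shows "padded_language (R O S) =
    {w. \<exists>n. w @ replicate n (None, None) \<in> map (\<lambda>(x, y, z). (x, z)) `
      ({t \<in> lists T. map (\<lambda>(x, y, z). (x, y)) t \<in> padded_language R} \<inter>
       {t \<in> lists T. map (\<lambda>(x, y, z). (y, z)) t \<in> padded_language S})}" (is "_ = ?rhs")
proof (intro equalityI subsetI)
  fix w assume "w \<in> padded_language (R O S)"
  then obtain u v t where uvt: "(u, v) \<in> R" "(v, t) \<in> S"
    and w: "padded_by u (map fst w)" "padded_by t (map snd w)"
    by (auto simp: padded_language_def)
  \<comment> \<open>The padding makes room for all of \<open>v\<close> on the middle track.\<close>
  define w' where "w' = w @ replicate (length v) (None, None)"
  define y where "y = map Some v @ replicate (length w) None"
  let ?t = "zip (map fst w') (zip y (map snd w'))"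
  have len: "length y = length w'"
    by (simp add: y_def w'_def)
  have w': "padded_by u (map fst w')" "padded_by t (map snd w')" and y: "padded_by v y"
    using w by (auto simp: w'_def y_def map_replicate_const padded_by_def[of v])
  have lists: "u \<in> lists A" "v \<in> lists A" "t \<in> lists A"
    using assms(1,2) uvt by auto
  have 1: "map (\<lambda>(x, y, z). (x, y)) ?t = zip (map fst w') y"
    and 2: "map (\<lambda>(x, y, z). (y, z)) ?t = zip y (map snd w')"
    and 3: "map (\<lambda>(x, y, z). (x, z)) ?t = w'"
    using len by (auto intro!: nth_equalityI)
  have letters: "set (map fst w') \<subseteq> padded_alphabet A" "set y \<subseteq> padded_alphabet A"
    "set (map snd w') \<subseteq> padded_alphabet A"
    using lists padded_by_lists[OF w'(1)] padded_by_lists[OF w'(2)] padded_by_lists[OF y]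
    by (simp_all only: lists_eq_set mem_Collect_eq)
  have "p \<in> T" if "p \<in> set ?t" for p
  proof -
    obtain a b c where p: "p = (a, b, c)"
      by (rule prod_cases3)
    with that have "a \<in> set (map fst w')" "(b, c) \<in> set (zip y (map snd w'))"
      by (auto simp only: dest: set_zip_leftD set_zip_rightD)
    then show ?thesis
      using letters set_zip_leftD[of b c y] set_zip_rightD[of b c y]
      unfolding p T_def mem_Sigma_iff by blast
  qed
  then have "?t \<in> lists T"
    by (simp only: lists_eq_set mem_Collect_eq subset_iff) blast
  moreover have "zip (map fst w') y \<in> padded_language R" "zip y (map snd w') \<in> padded_language S"
    using uvt w' y len by (auto simp: padded_language_def)
  ultimately have "w' \<in> map (\<lambda>(x, y, z). (x, z)) `
      ({t \<in> lists T. map (\<lambda>(x, y, z). (x, y)) t \<in> padded_language R} \<inter>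
       {t \<in> lists T. map (\<lambda>(x, y, z). (y, z)) t \<in> padded_language S})"
    using 1 2 3 by (intro image_eqI[of _ _ ?t]) auto
  then show "w \<in> ?rhs"
    by (auto simp: w'_def)
next
  fix w assume "w \<in> ?rhs"
  then obtain n t where w: "w @ replicate n (None, None) = map (\<lambda>(x, y, z). (x, z)) t"
    and t: "map (\<lambda>(x, y, z). (x, y)) t \<in> padded_language R"
           "map (\<lambda>(x, y, z). (y, z)) t \<in> padded_language S"
    by auto
  have fst_w: "map fst w @ replicate n None = map fst t"
    using arg_cong[OF w, of "map fst"] by (simp add: comp_def case_prod_unfold map_replicate_const)
  have snd_w: "map snd w @ replicate n None = map (snd \<circ> snd) t"
    using arg_cong[OF w, of "map snd"] by (simp add: comp_def case_prod_unfold map_replicate_const)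
  obtain u v where uv: "(u, v) \<in> R" "padded_by u (map fst t)" "padded_by v (map (fst \<circ> snd) t)"
    using t(1) by (auto simp: padded_language_def comp_def case_prod_unfold)
  obtain v' s where vs: "(v', s) \<in> S" "padded_by v' (map (fst \<circ> snd) t)"
      "padded_by s (map (snd \<circ> snd) t)"
    using t(2) by (auto simp: padded_language_def comp_def case_prod_unfold)
  have "v = v'"
    using uv(3) vs(2) by (rule padded_by_unique)
  moreover have "padded_by u (map fst w)" "padded_by s (map snd w)"
    using uv(2) vs(3) padded_by_append_None fst_w snd_w by metis+
  ultimately show "w \<in> padded_language (R O S)"
    using uv(1) vs(1) by (auto simp: padded_language_def)
qed

lemma regular_relation_relcomp:
  assumes "regular_relation A R" "R \<subseteq> lists A \<times> lists A"
    and "regular_relation A S" "S \<subseteq> lists A \<times> lists A"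
  shows "regular_relation A (R O S)"
proof (rule regular_relationI)
  let ?P = "padded_alphabet A"
  let ?T = "?P \<times> ?P \<times> ?P"
  have fin: "finite ?T"
    using regular_finite_alphabet[OF regular_padded_language[OF assms(1)]]
    by (simp add: finite_cartesian_product_iff)
  have "regular ?T {t \<in> lists ?T. map (\<lambda>(x, y, z). (x, y)) t \<in> padded_language R}"
    "regular ?T {t \<in> lists ?T. map (\<lambda>(x, y, z). (y, z)) t \<in> padded_language S}"
    by (rule regular_vimage_map[OF regular_padded_language[OF assms(1)] fin], force,
        rule regular_vimage_map[OF regular_padded_language[OF assms(3)] fin], force)
  then have "regular ((\<lambda>(x, y, z). (x, z)) ` ?T) (map (\<lambda>(x, y, z). (x, z)) `
      ({t \<in> lists ?T. map (\<lambda>(x, y, z). (x, y)) t \<in> padded_language R} \<inter>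
       {t \<in> lists ?T. map (\<lambda>(x, y, z). (y, z)) t \<in> padded_language S}))"
    by (intro regular_image_map regular_Int)
  moreover have "(\<lambda>(x, y, z). (x, z)) ` (X \<times> X \<times> X) = X \<times> X" for X :: "'a option set"
    by force
  then have "(\<lambda>(x, y, z). (x, z)) ` ?T = ?P \<times> ?P" .
  ultimately show "regular (?P \<times> ?P) (padded_language (R O S))"
    unfolding padded_language_relcomp[OF assms(2,4)] by (intro regular_strip_star) simp
qed (use assms(2,4) in auto)

lemma regular_relation_Times:
  assumes "regular A L"
  shows "regular_relation A (L \<times> L)"
proof -
  let ?P = "padded_alphabet A"
  have fin: "finite A"
    using assms by (rule regular_finite_alphabet)
  have LA: "L \<subseteq> lists A"
    using assms by (rule regular_subset_lists)
  have "regular (Some ` A) {w \<in> lists (Some ` A). map the w \<in> L}"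
    using assms fin by (rule regular_vimage_map[OF _ finite_imageI]) auto
  also have "{w \<in> lists (Some ` A). map the w \<in> L} = map Some ` L"
  proof (intro equalityI subsetI)
    fix w assume w: "w \<in> {w \<in> lists (Some ` A). map the w \<in> L}"
    then have "map Some (map the w) = w"
      by (auto intro!: map_idI)
    with w show "w \<in> map Some ` L"
      by (metis (mono_tags, lifting) imageI mem_Collect_eq)
  qed (use LA in \<open>fastforce simp: comp_def\<close>)
  finally have "regular ?P {w @ replicate n None | w n. w \<in> map Some ` L}"
    by (rule regular_append_star)
  also have "{w @ replicate n None | w n. w \<in> map Some ` L} = {w. \<exists>u\<in>L. padded_by u w}"
    by (auto simp: padded_by_def)
  finally have pad: "regular ?P {w. \<exists>u\<in>L. padded_by u w}" .
  have "regular (?P \<times> ?P) ({w \<in> lists (?P \<times> ?P). map fst w \<in> {w. \<exists>u\<in>L. padded_by u w}} \<inter>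
      {w \<in> lists (?P \<times> ?P). map snd w \<in> {w. \<exists>u\<in>L. padded_by u w}})"
    using pad fin by (intro regular_Int regular_vimage_map[OF pad]) auto
  also have "{w \<in> lists (?P \<times> ?P). map fst w \<in> {w. \<exists>u\<in>L. padded_by u w}} \<inter>
      {w \<in> lists (?P \<times> ?P). map snd w \<in> {w. \<exists>u\<in>L. padded_by u w}} = padded_language (L \<times> L)"
  proof (intro equalityI subsetI)
    fix w assume "w \<in> padded_language (L \<times> L)"
    then obtain u v where uv: "u \<in> L" "v \<in> L" "padded_by u (map fst w)" "padded_by v (map snd w)"
      by (auto simp: padded_language_def)
    then have "map fst w \<in> lists ?P" "map snd w \<in> lists ?P"
      using LA by (simp_all only: padded_by_lists) auto
    moreover have "w \<in> lists (X \<times> X)" if "map fst w \<in> lists X" "map snd w \<in> lists X" for X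
      using that by (induction w) auto
    ultimately have "w \<in> lists (?P \<times> ?P)"
      by metis
    with uv show "w \<in> {w \<in> lists (?P \<times> ?P). map fst w \<in> {w. \<exists>u\<in>L. padded_by u w}} \<inter>
      {w \<in> lists (?P \<times> ?P). map snd w \<in> {w. \<exists>u\<in>L. padded_by u w}}"
      by blast
  qed (auto simp: padded_language_def)
  finally show ?thesis
    using LA by (intro regular_relationI) auto
qed

lemma regular_relation_vimage:
  assumes "regular_relation A R" "regular B K" "f ` B \<subseteq> A"
  shows "regular_relation B {(u, v) \<in> K \<times> K. (map f u, map f v) \<in> R}"
proof -
  let ?f = "map_prod (map_option f) (map_option f)"
  have "regular (pair_alphabet B) ((\<lambda>(u, v). u \<diamond> v) ` (K \<times> K) \<inter>
      {w \<in> lists (pair_alphabet B). map ?f w \<in> (\<lambda>(u, v). u \<diamond> v) ` R})"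
  proof (intro regular_Int regular_relation_Times regular_vimage_map[OF assms(1)])
    show "finite (pair_alphabet B)"
      using regular_finite_alphabet[OF assms(2)] by (rule finite_pair_alphabet)
    show "?f ` pair_alphabet B \<subseteq> pair_alphabet A"
      using assms(3) by (auto simp: pair_alphabet_def)
  qed (fact assms(2))
  also have "(\<lambda>(u, v). u \<diamond> v) ` (K \<times> K) \<inter>
      {w \<in> lists (pair_alphabet B). map ?f w \<in> (\<lambda>(u, v). u \<diamond> v) ` R} =
    (\<lambda>(u, v). u \<diamond> v) ` {(u, v) \<in> K \<times> K. (map f u, map f v) \<in> R}"
  proof (intro equalityI subsetI)
    fix w assume "w \<in> (\<lambda>(u, v). u \<diamond> v) ` {(u, v) \<in> K \<times> K. (map f u, map f v) \<in> R}"
    then obtain u v where uv: "u \<in> K" "v \<in> K" "(map f u, map f v) \<in> R" and w: "w = u \<diamond> v"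
      by auto
    moreover have "w \<in> lists (pair_alphabet B)"
      unfolding w using uv regular_subset_lists[OF assms(2)] by (intro diamond_in_lists) auto
    ultimately show "w \<in> (\<lambda>(u, v). u \<diamond> v) ` (K \<times> K) \<inter>
      {w \<in> lists (pair_alphabet B). map ?f w \<in> (\<lambda>(u, v). u \<diamond> v) ` R}"
      by (auto simp: map_diamond)
  qed (auto simp: map_diamond diamond_inject)
  finally show ?thesis .
qed

text \<open>The pair \<open>u \<diamond> u\<close> needs no padding, so it is a letter-to-letter image of \<open>u\<close>.\<close>

lemma regular_diagonal:
  assumes "regular_relation A R" "R \<subseteq> lists A \<times> lists A"
  shows "regular A {u. (u, u) \<in> R}"
proof -
  have "regular A {w \<in> lists A. map (\<lambda>a. (Some a, Some a)) w \<in> (\<lambda>(u, v). u \<diamond> v) ` R}"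
    using finite_pair_alphabetD[OF regular_finite_alphabet[OF assms(1)]]
    by (intro regular_vimage_map[OF assms(1)]) (auto simp: pair_alphabet_def)
  also have "{w \<in> lists A. map (\<lambda>a. (Some a, Some a)) w \<in> (\<lambda>(u, v). u \<diamond> v) ` R} = {u. (u, u) \<in> R}"
    using assms(2) by (auto simp: diamond_inject simp flip: diamond_same)
  finally show ?thesis .
qed


section \<open>Runs of automata\<close>

text \<open>A run is recorded as its sequence of transitions, a state together with the letter read in
  it. The state reached at the end is left out, so that runs have the length of the input
  word.\<close>

fun run :: "('s \<Rightarrow> 'a \<Rightarrow> 's) \<Rightarrow> 's \<Rightarrow> 'a list \<Rightarrow> ('s \<times> 'a) list" where
  "run \<delta> q [] = []"
| "run \<delta> q (a # w) = (q, a) # run \<delta> (\<delta> q a) w"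

lemma map_snd_run [simp]: "map snd (run \<delta> q w) = w"
  by (induction w arbitrary: q) auto

lemma in_set_runE:
  assumes "(r, a) \<in> set (run \<delta> q w)"
  obtains u v where "w = u @ a # v" "r = foldl \<delta> q u"
proof -
  have "\<exists>u v. w = u @ a # v \<and> r = foldl \<delta> q u"
    using assms
  proof (induction w arbitrary: q)
    case (Cons b w)
    then consider "r = q" "a = b" | "(r, a) \<in> set (run \<delta> (\<delta> q b) w)"
      by auto
    then show ?case
    proof cases
      case 1
      then have "b # w = [] @ a # w \<and> r = foldl \<delta> q []" by simp
      then show ?thesis by blast
    next
      case 2
      from Cons.IH[OF this] obtain u v where "w = u @ a # v" "r = foldl \<delta> (\<delta> q b) u"
        by blast
      then have "b # w = (b # u) @ a # v \<and> r = foldl \<delta> q (b # u)" by simp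
      then show ?thesis by blast
    qed
  qed simp
  with that show thesis by blast
qed

text \<open>A transition out of a state is only a possible first letter of runs that start in this
  state, and it leaves the accepting runs from its target. So there is at most one nonempty
  residual for each state.\<close>

lemma regular_accepting_runs:
  assumes "finite_state_automaton \<Sigma> M"
  shows "regular (states M \<times> \<Sigma>) (run (trans_fun M) (start M) ` language \<Sigma> M)"
proof (rule regularI)
  let ?\<delta> = "trans_fun M"
  define R where "R q = run ?\<delta> q ` {w \<in> lists \<Sigma>. foldl ?\<delta> q w \<in> final M}" for q
  have M: "finite \<Sigma>" "finite (states M)" "start M \<in> states M"
    "\<And>q a. q \<in> states M \<Longrightarrow> a \<in> \<Sigma> \<Longrightarrow> ?\<delta> q a \<in> states M"
    using assms by (auto simp: finite_state_automaton_def)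
  have L: "run ?\<delta> (start M) ` language \<Sigma> M = R (start M)"
    by (simp add: R_def language_def)
  show "finite (states M \<times> \<Sigma>)" "finite (insert {} (R ` states M))"
    using M by auto
  have "run ?\<delta> q w \<in> lists (states M \<times> \<Sigma>)" if "q \<in> states M" "w \<in> lists \<Sigma>" for q w
    using that(2,1) M(4) by (induction w arbitrary: q) auto
  then show "run ?\<delta> (start M) ` language \<Sigma> M \<subseteq> lists (states M \<times> \<Sigma>)"
    using M(3) by (auto simp only: language_def)
  have step: "residual [(r, a)] (R q) = (if r = q then R (?\<delta> q a) else {})" if "a \<in> \<Sigma>" for q r a
  proof (intro equalityI subsetI)
    fix v assume "v \<in> residual [(r, a)] (R q)"
    then obtain w where w: "w \<in> lists \<Sigma>" "foldl ?\<delta> q w \<in> final M" "(r, a) # v = run ?\<delta> q w"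
      by (auto simp: residual_def R_def)
    then show "v \<in> (if r = q then R (?\<delta> q a) else {})"
      by (cases w) (auto simp: R_def)
  next
    fix v assume "v \<in> (if r = q then R (?\<delta> q a) else {})"
    then obtain w where "r = q" "w \<in> lists \<Sigma>" "foldl ?\<delta> (?\<delta> q a) w \<in> final M"
        "v = run ?\<delta> (?\<delta> q a) w"
      by (auto simp: R_def split: if_splits)
    with that have "a # w \<in> {w \<in> lists \<Sigma>. foldl ?\<delta> q w \<in> final M}"
        "(r, a) # v = run ?\<delta> q (a # w)"
      by auto
    then show "v \<in> residual [(r, a)] (R q)"
      unfolding residual_def R_def
      by (metis (mono_tags, lifting) append_Cons append_Nil imageI mem_Collect_eq)
  qed
  have "residual w X \<in> insert {} (R ` states M)"
    if "w \<in> lists (states M \<times> \<Sigma>)" "X \<in> insert {} (R ` states M)" for w X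
    using that
  proof (induction w arbitrary: X)
    case (Cons x w)
    obtain r a where x: "x = (r, a)" "a \<in> \<Sigma>"
      using Cons.hyps by (cases x) auto
    have "residual [x] {} = {}"
      by (simp add: residual_def)
    then have "residual [x] X \<in> insert {} (R ` states M)"
      using Cons.prems step[OF x(2)] M(4)[OF _ x(2)] by (auto simp: x(1) split: if_splits)
    then show ?case
      using Cons.IH residual_append[of "[x]" w X] by simp
  qed simp
  then show "residual w (run ?\<delta> (start M) ` language \<Sigma> M) \<in> insert {} (R ` states M)"
    if "w \<in> lists (states M \<times> \<Sigma>)" for w
    unfolding L using that M(3) by blast
qed

lemma regular_occurring_letters:
  assumes "regular \<Sigma> L"
  shows "regular (\<Union>w\<in>L. set w) L"
proof -
  let ?\<Gamma> = "\<Union>w\<in>L. set w"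
  have sub: "?\<Gamma> \<subseteq> \<Sigma>"
    using regular_subset_lists[OF assms] by auto
  have "regular ?\<Gamma> {w \<in> lists ?\<Gamma>. map id w \<in> L}"
    using sub finite_subset[OF sub regular_finite_alphabet[OF assms]]
    by (intro regular_vimage_map[OF assms]) auto
  also have "{w \<in> lists ?\<Gamma>. map id w \<in> L} = L"
    by auto
  finally show ?thesis .
qed


section \<open>Multiplication in a biautomatic group\<close>

lemma biautomatic_structure_mult:
  assumes "biautomatic_structure G A \<pi> L" "x \<in> {[]} \<union> {[a] | a. a \<in> A}"
  shows "regular (pair_alphabet A) {u \<diamond> v | u v. u \<in> L \<and> v \<in> L \<and> \<pi> v = \<pi> (u @ x)}"
    and "regular (pair_alphabet A) {u \<diamond> v | u v. u \<in> L \<and> v \<in> L \<and> \<pi> v = \<pi> (x @ u)}"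
proof -
  have "regular (pair_alphabet A) {u \<diamond> v | u v. u \<in> L \<and> v \<in> L \<and> \<pi> v = \<pi> (u @ x)} \<and>
      regular (pair_alphabet A) {u \<diamond> v | u v. u \<in> L \<and> v \<in> L \<and> \<pi> v = \<pi> (x @ u)}"
    using assms(1) unfolding biautomatic_structure_def by (elim conjE) (erule bspec, rule assms(2))
  then show "regular (pair_alphabet A) {u \<diamond> v | u v. u \<in> L \<and> v \<in> L \<and> \<pi> v = \<pi> (u @ x)}"
    "regular (pair_alphabet A) {u \<diamond> v | u v. u \<in> L \<and> v \<in> L \<and> \<pi> v = \<pi> (x @ u)}"
    by (rule conjunct1, rule conjunct2)
qed

locale biautomatic_group = group G for G :: "('g, 'b) monoid_scheme" (structure) +
  fixes A :: "'a set" and \<pi> :: "'a list \<Rightarrow> 'g" and L :: "'a list set"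
  assumes biautomatic: "biautomatic_structure G A \<pi> L"
begin

lemma evaluation_Nil [simp]: "\<pi> [] = \<one>"
  using biautomatic by (simp add: biautomatic_structure_def)

lemma evaluation_closed [simp]: "u \<in> lists A \<Longrightarrow> \<pi> u \<in> carrier G"
  using biautomatic by (auto simp: biautomatic_structure_def)

lemma evaluation_append: "u \<in> lists A \<Longrightarrow> v \<in> lists A \<Longrightarrow> \<pi> (u @ v) = \<pi> u \<otimes> \<pi> v"
  using biautomatic by (auto simp: biautomatic_structure_def hom_def free_monoid_def)

lemma evaluation_onto:
  assumes "g \<in> carrier G"
  shows "\<exists>u \<in> lists A. \<pi> u = g"
proof -
  have "g \<in> \<pi> ` lists A"
    using biautomatic assms by (simp add: biautomatic_structure_def)
  then show ?thesis by blast
qed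

lemma evaluation_onto_L:
  assumes "g \<in> carrier G"
  shows "\<exists>u \<in> L. \<pi> u = g"
proof -
  have "g \<in> \<pi> ` L"
    using biautomatic assms by (simp add: biautomatic_structure_def)
  then show ?thesis by blast
qed

lemma regular_L: "regular A L"
  using biautomatic by (simp add: biautomatic_structure_def)

lemma L_lists: "L \<subseteq> lists A"
  using regular_L by (rule regular_subset_lists)

definition multiplier :: "'g \<Rightarrow> 'g \<Rightarrow> ('a list \<times> 'a list) set" where
  "multiplier g h = {(u, v). u \<in> L \<and> v \<in> L \<and> \<pi> v = g \<otimes> \<pi> u \<otimes> h}"

lemma multiplier_lists: "multiplier g h \<subseteq> lists A \<times> lists A"
  using L_lists by (auto simp: multiplier_def)

text \<open>An intermediate word exists because every element of the group has a representative
  in \<open>L\<close>.\<close>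

lemma multiplier_relcomp:
  assumes "g \<in> carrier G" "h \<in> carrier G" "g' \<in> carrier G" "h' \<in> carrier G"
  shows "multiplier g h O multiplier g' h' = multiplier (g' \<otimes> g) (h \<otimes> h')"
proof (intro equalityI subrelI)
  fix u t assume "(u, t) \<in> multiplier g h O multiplier g' h'"
  then obtain v where "u \<in> L" "t \<in> L" "\<pi> v = g \<otimes> \<pi> u \<otimes> h" "\<pi> t = g' \<otimes> \<pi> v \<otimes> h'"
    by (auto simp: multiplier_def)
  then show "(u, t) \<in> multiplier (g' \<otimes> g) (h \<otimes> h')"
    using assms L_lists by (auto simp: multiplier_def m_assoc subset_iff)
next
  fix u t assume ut: "(u, t) \<in> multiplier (g' \<otimes> g) (h \<otimes> h')"
  then have u: "u \<in> lists A"
    using L_lists by (auto simp: multiplier_def)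
  then obtain v where "v \<in> L" "\<pi> v = g \<otimes> \<pi> u \<otimes> h"
    using evaluation_onto_L[of "g \<otimes> \<pi> u \<otimes> h"] assms by auto
  then have "(u, v) \<in> multiplier g h" "(v, t) \<in> multiplier g' h'"
    using ut u assms by (auto simp: multiplier_def m_assoc)
  then show "(u, t) \<in> multiplier g h O multiplier g' h'"
    by auto
qed

lemma regular_multiplier_generator:
  assumes "x \<in> {[]} \<union> {[a] | a. a \<in> A}"
  shows "regular_relation A (multiplier \<one> (\<pi> x))" "regular_relation A (multiplier (\<pi> x) \<one>)"
proof -
  have x: "x \<in> lists A"
    using assms by auto
  have "\<pi> (u @ x) = \<one> \<otimes> \<pi> u \<otimes> \<pi> x" "\<pi> (x @ u) = \<pi> x \<otimes> \<pi> u \<otimes> \<one>" if "u \<in> L" for u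
    using x subsetD[OF L_lists that] by (simp_all add: evaluation_append)
  then have "{u \<diamond> v | u v. u \<in> L \<and> v \<in> L \<and> \<pi> v = \<pi> (u @ x)} =
      {u \<diamond> v | u v. (u, v) \<in> multiplier \<one> (\<pi> x)}"
    "{u \<diamond> v | u v. u \<in> L \<and> v \<in> L \<and> \<pi> v = \<pi> (x @ u)} =
      {u \<diamond> v | u v. (u, v) \<in> multiplier (\<pi> x) \<one>}"
    by (simp_all add: multiplier_def cong: conj_cong)
  then show "regular_relation A (multiplier \<one> (\<pi> x))" "regular_relation A (multiplier (\<pi> x) \<one>)"
    using biautomatic_structure_mult[OF biautomatic assms] by (simp_all only: diamond_image)
qed

lemma regular_multiplier:
  assumes "g \<in> carrier G" "h \<in> carrier G"
  shows "regular_relation A (multiplier g h)"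
proof -
  have comp: "regular_relation A (multiplier (g' \<otimes> g) (h \<otimes> h'))"
    if "regular_relation A (multiplier g h)" "regular_relation A (multiplier g' h')"
      "g \<in> carrier G" "h \<in> carrier G" "g' \<in> carrier G" "h' \<in> carrier G" for g h g' h'
    using regular_relation_relcomp[OF that(1) multiplier_lists that(2) multiplier_lists]
    by (simp add: multiplier_relcomp that)
  have right: "regular_relation A (multiplier \<one> (\<pi> x))" if "x \<in> lists A" for x
    using that
  proof (induction x rule: rev_induct)
    case Nil
    show ?case using regular_multiplier_generator(1)[of "[]"] by simp
  next
    case (snoc a x)
    then show ?case
      using comp[OF snoc.IH regular_multiplier_generator(1)[of "[a]"]]
      by (simp add: evaluation_append)
  qed
  have left: "regular_relation A (multiplier (\<pi> x) \<one>)" if "x \<in> lists A" for x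
    using that
  proof (induction x)
    case Nil
    show ?case using regular_multiplier_generator(2)[of "[]"] by simp
  next
    case (Cons a x)
    then show ?case
      using comp[OF Cons.IH regular_multiplier_generator(2)[of "[a]"]] evaluation_append[of "[a]" x]
      by simp
  qed
  obtain x y where "x \<in> lists A" "\<pi> x = g" "y \<in> lists A" "\<pi> y = h"
    using evaluation_onto assms by metis
  then show ?thesis
    using comp[OF left right] assms by fastforce
qed


text \<open>A word commutes with \<open>s\<close> iff it represents its own conjugate under \<open>s\<close>, which places it on
  the diagonal of a multiplier relation.\<close>

lemma regular_centralizer:
  assumes "finite S" "S \<subseteq> carrier G"
  shows "regular A {u \<in> L. \<pi> u \<in> centralizer G S}"
  using assms
proof (induction S)
  case empty
  have "{u \<in> L. \<pi> u \<in> centralizer G {}} = L"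
    using subsetD[OF L_lists] by (auto simp: centralizer_def simp del: in_lists_conv_set)
  then show ?case using regular_L by simp
next
  case (insert s S)
  then have s: "s \<in> carrier G" by simp
  have "\<pi> u = inv s \<otimes> \<pi> u \<otimes> s \<longleftrightarrow> \<pi> u \<otimes> s = s \<otimes> \<pi> u" if "u \<in> L" for u
  proof -
    have "\<pi> u \<in> carrier G" using that L_lists evaluation_closed by blast
    then show ?thesis using s by (metis inv_closed inv_solve_left m_assoc m_closed)
  qed
  then have "{u \<in> L. \<pi> u \<in> centralizer G (insert s S)} =
      {u \<in> L. \<pi> u \<in> centralizer G S} \<inter> {u. (u, u) \<in> multiplier (inv s) s}"
    by (auto simp: centralizer_def multiplier_def)
  moreover have "regular A {u. (u, u) \<in> multiplier (inv s) s}"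
    using s by (intro regular_diagonal regular_multiplier multiplier_lists) auto
  ultimately show ?case
    using insert by (auto intro: regular_Int)
qed


section \<open>Rational subgroups\<close>

text \<open>The new alphabet \<open>B\<close> consists of the transitions in accepting runs of an automaton for the
  representatives of \<open>H\<close>, and the new language \<open>K\<close> of these runs. Only such transitions may be
  used, since the value of a transition is guaranteed to lie in \<open>H\<close> if its source is reachable
  and its target can still lead to acceptance.\<close>

theorem rational_subgroup_biautomatic:
  assumes H: "subgroup H G" and rational: "regular A {u \<in> L. \<pi> u \<in> H}"
  shows "\<exists>(B :: (nat \<times> 'a) set) \<rho> K. biautomatic_structure (G\<lparr>carrier := H\<rparr>) B \<rho> K"
proof -
  obtain M :: "(nat, 'a) automaton"
    where M: "finite_state_automaton A M" and LH: "{u \<in> L. \<pi> u \<in> H} = language A M"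
    using rational by (auto simp: regular_def)
  let ?\<delta> = "trans_fun M" and ?q0 = "start M"
  have accepted: "\<pi> u \<in> H" if "u \<in> lists A" "foldl ?\<delta> ?q0 u \<in> final M" for u
    using that LH by (auto simp: language_def)
  have HG: "H \<subseteq> carrier G"
    using H by (rule subgroup.subset)
  \<comment> \<open>For each state an element that leads back into \<open>H\<close>. It is trivial for the initial and the
    final states, so that no correction is left at the two ends of an accepting run.\<close>
  have "\<exists>g. g \<in> carrier G \<and> (q = ?q0 \<or> q \<in> final M \<longrightarrow> g = \<one>) \<and>
    (\<forall>u v. u \<in> lists A \<longrightarrow> v \<in> lists A \<longrightarrow> foldl ?\<delta> ?q0 u = q \<longrightarrow> foldl ?\<delta> q v \<in> final M \<longrightarrow>
      \<pi> u \<otimes> g \<in> H)" for q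
  proof -
    consider "q = ?q0 \<or> q \<in> final M"
      | z where "\<not> (q = ?q0 \<or> q \<in> final M)" "z \<in> lists A" "foldl ?\<delta> q z \<in> final M"
      | "\<not> (q = ?q0 \<or> q \<in> final M)" "\<forall>z \<in> lists A. foldl ?\<delta> q z \<notin> final M"
      by blast
    then show ?thesis
    proof cases
      case 1
      have "\<pi> u \<in> H"
        if uv: "u \<in> lists A" "v \<in> lists A" "foldl ?\<delta> ?q0 u = q" "foldl ?\<delta> q v \<in> final M" for u v
        using 1
      proof
        \<comment> \<open>A loop \<open>u\<close> at the initial state can be cancelled from an accepted word \<open>u v\<close>.\<close>
        assume "q = ?q0"
        then have "\<pi> v \<in> H" "\<pi> (u @ v) \<in> H"
          using uv accepted[of v] accepted[of "u @ v"] by simp_all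
        then have "\<pi> (u @ v) \<otimes> inv \<pi> v \<in> H"
          using H by (simp add: subgroup.m_closed subgroup.m_inv_closed)
        then show ?thesis
          using uv by (simp add: evaluation_append m_assoc)
      qed (use uv accepted[of u] in simp)
      then show ?thesis
        by (intro exI[of _ \<one>]) auto
    next
      case 2
      then have "\<pi> u \<otimes> \<pi> z \<in> H" if "u \<in> lists A" "foldl ?\<delta> ?q0 u = q" for u
        using that accepted[of "u @ z"] by (simp add: evaluation_append)
      with 2 show ?thesis
        by (intro exI[of _ "\<pi> z"]) auto
    next
      case 3
      then show ?thesis
        by (intro exI[of _ \<one>]) auto
    qed
  qed
  then obtain h where h_closed [simp]: "\<And>q. h q \<in> carrier G"
    and h_start: "h ?q0 = \<one>" and h_final: "\<And>q. q \<in> final M \<Longrightarrow> h q = \<one>"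
    and h_return: "\<And>u v. u \<in> lists A \<Longrightarrow> v \<in> lists A \<Longrightarrow> foldl ?\<delta> ?q0 (u @ v) \<in> final M \<Longrightarrow>
      \<pi> u \<otimes> h (foldl ?\<delta> ?q0 u) \<in> H"
    by (simp only: foldl_append) metis
  define K where "K = run ?\<delta> ?q0 ` {u \<in> L. \<pi> u \<in> H}"
  define B where "B = (\<Union>w\<in>K. set w)"
  define val where "val = (\<lambda>(q, a). inv h q \<otimes> \<pi> [a] \<otimes> h (?\<delta> q a))"
  define \<rho> where "\<rho> w = foldr (\<lambda>b x. val b \<otimes> x) w \<one>" for w
  have K: "regular B K"
    using regular_occurring_letters[OF regular_accepting_runs[OF M]] by (simp add: B_def K_def LH)
  have K_lists: "K \<subseteq> lists B"
    using K by (rule regular_subset_lists)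
  have B_A: "snd ` B \<subseteq> A"
  proof -
    have "set w \<subseteq> A" if "w \<in> L" for w
      using that L_lists by auto
    moreover have "snd ` set (run ?\<delta> ?q0 w) = set w" for w
      by (metis list.set_map map_snd_run)
    ultimately show ?thesis
      by (fastforce simp: B_def K_def)
  qed
  have val_H: "val b \<in> H" if "b \<in> B" for b
  proof -
    obtain q a where b: "b = (q, a)" by (cases b)
    with that obtain w where w: "w \<in> {u \<in> L. \<pi> u \<in> H}" "(q, a) \<in> set (run ?\<delta> ?q0 w)"
      by (auto simp: B_def K_def)
    from w(2) obtain u v where uv: "w = u @ a # v" and q: "q = foldl ?\<delta> ?q0 u"
      by (rule in_set_runE)
    have lists: "u \<in> lists A" "[a] \<in> lists A" "v \<in> lists A"
      and acc: "foldl ?\<delta> ?q0 w \<in> final M"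
      using w(1) unfolding LH by (auto simp: language_def uv)
    have "\<pi> u \<otimes> h q \<in> H" "\<pi> (u @ [a]) \<otimes> h (?\<delta> q a) \<in> H"
      using h_return[of u "a # v"] h_return[of "u @ [a]" v] lists acc by (simp_all add: uv q)
    then have "inv (\<pi> u \<otimes> h q) \<otimes> (\<pi> (u @ [a]) \<otimes> h (?\<delta> q a)) \<in> H"
      using H by (simp add: subgroup.m_closed subgroup.m_inv_closed)
    also have "inv (\<pi> u \<otimes> h q) \<otimes> (\<pi> (u @ [a]) \<otimes> h (?\<delta> q a)) = val b"
      using lists by (simp add: b val_def evaluation_append inv_mult_group m_assoc inv_solve_left')
    finally show ?thesis .
  qed
  have \<rho>_H: "\<rho> w \<in> H" if "w \<in> lists B" for w
    using that H val_H by (induction w) (auto simp: \<rho>_def subgroup.one_closed subgroup.m_closed)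
  have \<rho>_append: "\<rho> (u @ v) = \<rho> u \<otimes> \<rho> v" if "u \<in> lists B" "v \<in> lists B" for u v
    using that(1)
  proof (induction u)
    case Nil
    then show ?case using \<rho>_H[OF that(2)] HG by (auto simp: \<rho>_def)
  next
    case (Cons b u)
    then have "val b \<in> carrier G" "\<rho> u \<in> carrier G" "\<rho> v \<in> carrier G"
      using val_H[of b] \<rho>_H[of u] \<rho>_H[of v] that(2) HG by blast+
    with Cons show ?case by (simp add: \<rho>_def m_assoc)
  qed
  \<comment> \<open>The product telescopes.\<close>
  have \<rho>_run: "\<rho> (run ?\<delta> q w) = inv h q \<otimes> \<pi> w \<otimes> h (foldl ?\<delta> q w)" if "w \<in> lists A" for q w
    using that
  proof (induction w arbitrary: q)
    case Nil
    show ?case by (simp add: \<rho>_def)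
  next
    case (Cons a w)
    have "\<rho> (run ?\<delta> q (a # w)) = val (q, a) \<otimes> \<rho> (run ?\<delta> (?\<delta> q a) w)"
      by (simp add: \<rho>_def)
    also have "\<dots> = inv h q \<otimes> (\<pi> [a] \<otimes> \<pi> w) \<otimes> h (foldl ?\<delta> (?\<delta> q a) w)"
    proof -
      have "h (?\<delta> q a) \<otimes> (inv h (?\<delta> q a) \<otimes> x) = x" if "x \<in> carrier G" for x
        using that by (simp flip: m_assoc)
      with Cons show ?thesis by (simp add: val_def m_assoc)
    qed
    also have "\<dots> = inv h q \<otimes> \<pi> (a # w) \<otimes> h (foldl ?\<delta> q (a # w))"
      using Cons.hyps evaluation_append[of "[a]" w] by simp
    finally show ?case .
  qed
  have \<rho>_K: "\<rho> w = \<pi> (map snd w)" if w: "w \<in> K" for w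
  proof -
    obtain u where u: "u \<in> language A M" "w = run ?\<delta> ?q0 u"
      using w unfolding K_def LH by blast
    then show ?thesis
      using \<rho>_run[of u ?q0] by (simp add: h_start h_final language_def)
  qed
  have snd_K: "map snd w \<in> L" if "w \<in> K" for w
    using that by (auto simp: K_def)
  have \<rho>_onto: "\<rho> ` K = H"
  proof -
    have "\<rho> ` K = \<pi> ` map snd ` K"
      by (simp add: image_image \<rho>_K cong: image_cong)
    also have "map snd ` K = {u \<in> L. \<pi> u \<in> H}"
      by (simp add: K_def image_image)
    also have "\<pi> ` {u \<in> L. \<pi> u \<in> H} = H"
    proof (intro equalityI subsetI)
      fix x assume "x \<in> H"
      with evaluation_onto_L[of x] HG show "x \<in> \<pi> ` {u \<in> L. \<pi> u \<in> H}"
        by blast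
    qed blast
    finally show ?thesis .
  qed
  have mult: "regular (pair_alphabet B) {u \<diamond> v | u v. u \<in> K \<and> v \<in> K \<and> \<rho> v = g \<otimes> \<rho> u \<otimes> k}"
    if "g \<in> carrier G" "k \<in> carrier G" for g k
  proof -
    have "{u \<diamond> v | u v. u \<in> K \<and> v \<in> K \<and> \<rho> v = g \<otimes> \<rho> u \<otimes> k} =
        (\<lambda>(u, v). u \<diamond> v) ` {(u, v) \<in> K \<times> K. (map snd u, map snd v) \<in> multiplier g k}"
      by (force simp: multiplier_def \<rho>_K snd_K)
    then show ?thesis
      using regular_relation_vimage[OF regular_multiplier[OF that] K B_A] by simp
  qed
  have carrier_\<rho>: "\<rho> w \<in> carrier G" if "w \<in> lists B" for w
    using \<rho>_H[OF that] HG by auto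
  have "biautomatic_structure (G\<lparr>carrier := H\<rparr>) B \<rho> K"
    unfolding biautomatic_structure_def
  proof (intro conjI ballI)
    show "finite B"
      using K by (rule regular_finite_alphabet)
    show "\<rho> \<in> hom (free_monoid B) (G\<lparr>carrier := H\<rparr>)"
      using \<rho>_H \<rho>_append by (auto simp: hom_def free_monoid_def)
    show "\<rho> [] = \<one>\<^bsub>G\<lparr>carrier := H\<rparr>\<^esub>"
      by (simp add: \<rho>_def)
    show "\<rho> ` lists B = carrier (G\<lparr>carrier := H\<rparr>)"
      using \<rho>_H \<rho>_onto K_lists by auto
    show "regular B K" "\<rho> ` K = carrier (G\<lparr>carrier := H\<rparr>)"
      using K \<rho>_onto by simp_all
    fix x assume "x \<in> {[]} \<union> {[b] | b. b \<in> B}"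
    then have x: "x \<in> lists B"
      by auto
    have "\<rho> (u @ x) = \<one> \<otimes> \<rho> u \<otimes> \<rho> x" "\<rho> (x @ u) = \<rho> x \<otimes> \<rho> u \<otimes> \<one>" if "u \<in> K" for u
      using that x K_lists carrier_\<rho> by (auto simp: \<rho>_append subset_iff)
    then show "regular (pair_alphabet B) {u \<diamond> v | u v. u \<in> K \<and> v \<in> K \<and> \<rho> v = \<rho> (u @ x)}"
      "regular (pair_alphabet B) {u \<diamond> v | u v. u \<in> K \<and> v \<in> K \<and> \<rho> v = \<rho> (x @ u)}"
      using mult[OF one_closed carrier_\<rho>[OF x]] mult[OF carrier_\<rho>[OF x] one_closed]
      by (simp_all cong: conj_cong)
  qed
  then show ?thesis by blast
qed

end

text \<open>Being biautomatic is defined with letters that are natural numbers. This renaming brings an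
  alphabet of transitions into that form.\<close>

lemma biautomatic_structure_rename:
  assumes "biautomatic_structure G B \<rho> K" "inj f"
  shows "biautomatic_structure G (f ` B) (\<lambda>w. \<rho> (map (the_inv f) w)) (map f ` K)"
proof -
  let ?\<sigma> = "\<lambda>w. \<rho> (map (the_inv f) w)"
  have inv_f [simp]: "map (the_inv f) (map f w) = w" for w
    using assms(2) by (simp add: comp_def the_inv_f_f)
  have B: "finite B" "regular B K" and hom: "\<rho> \<in> hom (free_monoid B) G"
    using assms(1) by (simp_all add: biautomatic_structure_def)
  have lists: "lists (f ` B) = map f ` lists B"
    by (rule lists_image)
  have reg: "regular (pair_alphabet (f ` B)) {u \<diamond> v | u v.
      u \<in> map f ` K \<and> v \<in> map f ` K \<and> P (map (the_inv f) u) (map (the_inv f) v)}"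
    if "regular (pair_alphabet B) {u \<diamond> v | u v. u \<in> K \<and> v \<in> K \<and> P u v}" for P
  proof -
    let ?f = "map_prod (map_option f) (map_option f)"
    have "?f ` pair_alphabet B = pair_alphabet (f ` B)"
      by (simp add: pair_alphabet_def image_Un map_prod_surj_on image_image)
    moreover have "map ?f ` {u \<diamond> v | u v. u \<in> K \<and> v \<in> K \<and> P u v} =
      {map ?f (u \<diamond> v) | u v. u \<in> K \<and> v \<in> K \<and> P u v}"
      by blast
    moreover have "\<dots> = {u \<diamond> v | u v.
        u \<in> map f ` K \<and> v \<in> map f ` K \<and> P (map (the_inv f) u) (map (the_inv f) v)}"
      unfolding map_diamond
    proof (intro equalityI subsetI)
      fix w
      assume "w \<in> {map f u \<diamond> map f v | u v. u \<in> K \<and> v \<in> K \<and> P u v}"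
      then obtain u v where "u \<in> K" "v \<in> K" "P u v" "w = map f u \<diamond> map f v"
        by blast
      then show "w \<in> {u \<diamond> v | u v.
          u \<in> map f ` K \<and> v \<in> map f ` K \<and> P (map (the_inv f) u) (map (the_inv f) v)}"
        by (intro CollectI exI[of _ "map f u"] exI[of _ "map f v"]) (simp del: map_map)
    next
      fix w
      assume "w \<in> {u \<diamond> v | u v.
          u \<in> map f ` K \<and> v \<in> map f ` K \<and> P (map (the_inv f) u) (map (the_inv f) v)}"
      then obtain u v where "u \<in> K" "v \<in> K" "w = map f u \<diamond> map f v"
          "P (map (the_inv f) (map f u)) (map (the_inv f) (map f v))"
        by blast
      then show "w \<in> {map f u \<diamond> map f v | u v. u \<in> K \<and> v \<in> K \<and> P u v}"
        unfolding inv_f by blast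
    qed
    ultimately show ?thesis
      using regular_image_map[OF that, of ?f] by simp
  qed
  have image: "?\<sigma> ` map f ` X = \<rho> ` X" for X
    by (simp add: image_image del: map_map)
  show ?thesis
    unfolding biautomatic_structure_def
  proof (intro conjI ballI)
    show "finite (f ` B)" "regular (f ` B) (map f ` K)"
      using B regular_image_map by auto
    show "?\<sigma> \<in> hom (free_monoid (f ` B)) G" "?\<sigma> [] = \<one>\<^bsub>G\<^esub>"
      using hom assms(1) by (auto simp: hom_def free_monoid_def lists biautomatic_structure_def
        simp del: map_map)
    show "?\<sigma> ` lists (f ` B) = carrier G" "?\<sigma> ` map f ` K = carrier G"
      using assms(1) unfolding lists image by (simp_all add: biautomatic_structure_def)
    fix x assume "x \<in> {[]} \<union> {[b] | b. b \<in> f ` B}"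
    then obtain y where y: "y \<in> {[]} \<union> {[b] | b. b \<in> B}" and x: "x = map f y"
      by force
    have *: "map (the_inv f) (u @ x) = map (the_inv f) u @ y"
      "map (the_inv f) (x @ u) = y @ map (the_inv f) u" for u
      by (simp_all add: x del: map_map)
    show "regular (pair_alphabet (f ` B)) {u \<diamond> v | u v.
        u \<in> map f ` K \<and> v \<in> map f ` K \<and> ?\<sigma> v = ?\<sigma> (u @ x)}"
      unfolding * using biautomatic_structure_mult(1)[OF assms(1) y]
      by (rule reg[of "\<lambda>u v. \<rho> v = \<rho> (u @ y)"])
    show "regular (pair_alphabet (f ` B)) {u \<diamond> v | u v.
        u \<in> map f ` K \<and> v \<in> map f ` K \<and> ?\<sigma> v = ?\<sigma> (x @ u)}"
      unfolding * using biautomatic_structure_mult(2)[OF assms(1) y]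
      by (rule reg[of "\<lambda>u v. \<rho> v = \<rho> (y @ u)"])
  qed
qed

lemma (in group) subgroup_centralizer:
  assumes "S \<subseteq> carrier G"
  shows "subgroup (centralizer G S) G"
proof (rule subgroupI)
  have "\<one> \<in> centralizer G S"
    using assms by (auto simp: centralizer_def)
  then show "centralizer G S \<noteq> {}"
    by auto
next
  fix a assume a: "a \<in> centralizer G S"
  have "inv a \<otimes> s = s \<otimes> inv a" if "s \<in> S" for s
  proof -
    have "a \<in> carrier G" "s \<in> carrier G" "a \<otimes> s = s \<otimes> a"
      using a that assms by (auto simp: centralizer_def)
    then show ?thesis
      by (metis inv_closed inv_solve_left inv_solve_right m_assoc m_closed)
  qed
  then show "inv a \<in> centralizer G S"
    using a by (auto simp: centralizer_def)
next
  fix a b assume ab: "a \<in> centralizer G S" "b \<in> centralizer G S"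
  have "a \<otimes> b \<otimes> s = s \<otimes> (a \<otimes> b)" if "s \<in> S" for s
  proof -
    have "a \<in> carrier G" "b \<in> carrier G" "s \<in> carrier G" "a \<otimes> s = s \<otimes> a" "b \<otimes> s = s \<otimes> b"
      using ab that assms by (auto simp: centralizer_def)
    then show ?thesis
      by (metis m_assoc)
  qed
  then show "a \<otimes> b \<in> centralizer G S"
    using ab by (auto simp: centralizer_def)
qed (auto simp: centralizer_def)

theorem corollary5p10:
  fixes G :: "('g, 'b) monoid_scheme" and S :: "'g set"
  assumes "biautomatic G" and "finite S" and "S \<subseteq> carrier G"
  shows "biautomatic (G\<lparr>carrier := centralizer G S\<rparr>)"
proof -
  obtain A :: "nat set" and \<pi> L where "group G" "biautomatic_structure G A \<pi> L"
    using assms(1) by (auto simp: biautomatic_def)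
  then interpret biautomatic_group G A \<pi> L
    by (simp add: biautomatic_group_def biautomatic_group_axioms_def)
  have sub: "subgroup (centralizer G S) G"
    using assms(3) by (rule subgroup_centralizer)
  obtain B :: "(nat \<times> nat) set" and \<rho> K
    where "biautomatic_structure (G\<lparr>carrier := centralizer G S\<rparr>) B \<rho> K"
    using rational_subgroup_biautomatic[OF sub regular_centralizer[OF assms(2,3)]] by blast
  note biautomatic_structure_rename[OF this inj_prod_encode]
  moreover have "group (G\<lparr>carrier := centralizer G S\<rparr>)"
    using sub by (rule subgroup_imp_group)
  ultimately show ?thesis
    by (auto simp: biautomatic_def)
qed

end
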